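(* Let $G$ be a graph with no induced subgraph isomorphic to $C_5$, the bull, the gem, or the co-gem, and let $r\in\mathbb{N}\cup\{\infty\}$. Then the radius-$r$ flip-width of $G$ is at most $2$.
   Context: $\mathbb{N}$ is the set of positive integers. All graphs are finite, simple. For $A,B\subseteq V(G)$, $G\oplus(A,B)$ is the graph on $V(G)$ in which the adjacency of distinct $u,v$ is toggled exactly when $(u,v)\in(A\times B)\cup(B\times A)$; $G\oplus\mathcal{S}$ applies all flips in a collection $\mathcal{S}$. For a partition $\mathcal{P}$ of $V(G)$, a $\mathcal{P}$-flip is $G\oplus\mathcal{S}$ with all pairs in $\mathcal{S}$ of the form $(X,Y)$, $X,Y\in\mathcal{P}$; a $k$-flip is a $\mathcal{P}$-flip with $|\mathcal{P}|\le k$. Flipper game of radius $r\in\mathbb{N}\cup\{\infty\}$ and width $k$: $G_0=G$, the runner picks $v_0$; in round $i\ge1$ the flipper announces a $k$-flip $G_i$ of $G$, then the runner (knowing $G_i$) moves to $v_i$ reachable from $v_{i-1}$ by a path of length at most $r$ in $G_{i-1}$ (any vertex of the same component if $r=\infty$). The flipper wins when the runner's position $v_i$ is isolated in $G_i$. The radius-$r$ flip-width is the minimum $k$ such that the flipper has a winning strategy. $C_5$ is the 5-cycle; with $abcd$ an induced path and a fifth vertex $v$: the bull has $v$ adjacent exactly to $b,c$; the gem has $v$ adjacent to all of $a,b,c,d$; the co-gem has $v$ isolated. *)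

theory Defs
  imports
    "HOL-Library.Extended_Nat"
    "HOL-Library.Disjoint_Sets"
    "Graph_Theory.Pair_Digraph"
    "Graph_Theory.Digraph_Isomorphism"
begin

text \<open>
  A finite simple graph is a \<^typ>\<open>'a pair_pre_digraph\<close> \<open>G\<close> satisfying \<^term>\<open>pair_graph G\<close>:
  an undirected edge is represented by both of its orientations in \<open>parcs G\<close>.
\<close>

section \<open>Forbidden induced subgraphs\<close>

definition contains_induced :: "'a pair_pre_digraph \<Rightarrow> 'b pair_pre_digraph \<Rightarrow> bool" where
  "contains_induced G H \<longleftrightarrow>
     (\<exists>H'. induced_subgraph H' (with_proj G) \<and> digraph_iso H' (with_proj H))"

definition graph_of_edges :: "'a set \<Rightarrow> 'a rel \<Rightarrow> 'a pair_pre_digraph" where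
  "graph_of_edges V E = \<lparr>pverts = V, parcs = E \<union> E\<inverse>\<rparr>"

definition C5 :: "nat pair_pre_digraph" where
  "C5 = graph_of_edges {0,1,2,3,4} {(0,1), (1,2), (2,3), (3,4), (4,0)}"

text \<open>In the next three graphs the path \<open>abcd\<close> is \<open>0, 1, 2, 3\<close> and the fifth vertex is \<open>4\<close>.\<close>

definition bull :: "nat pair_pre_digraph" where
  "bull = graph_of_edges {0,1,2,3,4} {(0,1), (1,2), (2,3), (4,1), (4,2)}"

definition gem :: "nat pair_pre_digraph" where
  "gem = graph_of_edges {0,1,2,3,4} {(0,1), (1,2), (2,3), (4,0), (4,1), (4,2), (4,3)}"

definition co_gem :: "nat pair_pre_digraph" where
  "co_gem = graph_of_edges {0,1,2,3,4} {(0,1), (1,2), (2,3)}"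

section \<open>Flips\<close>

definition flip :: "'a set \<times> 'a set \<Rightarrow> 'a pair_pre_digraph \<Rightarrow> 'a pair_pre_digraph" where
  "flip = (\<lambda>(A, B) G. G\<lparr>parcs :=
     {(u, v). u \<in> pverts G \<and> v \<in> pverts G \<and> u \<noteq> v \<and>
              ((u, v) \<in> parcs G) \<noteq> ((u, v) \<in> A \<times> B \<union> B \<times> A)}\<rparr>)"

text \<open>
  All flips of a finite collection, one after the other. The order is irrelevant, see
  \<open>comp_fun_commute_flip\<close> below. A collection may contain both \<open>(A, B)\<close> and \<open>(B, A)\<close>,
  which then cancel.
\<close>

definition flips :: "('a set \<times> 'a set) set \<Rightarrow> 'a pair_pre_digraph \<Rightarrow> 'a pair_pre_digraph" where
  "flips S G = Finite_Set.fold flip G S"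

definition is_k_flip :: "nat \<Rightarrow> 'a pair_pre_digraph \<Rightarrow> 'a pair_pre_digraph \<Rightarrow> bool" where
  "is_k_flip k G H \<longleftrightarrow>
     (\<exists>P S. partition_on (pverts G) P \<and> card P \<le> k \<and> S \<subseteq> P \<times> P \<and> H = flips S G)"

section \<open>The flipper game\<close>

text \<open>For \<open>r = \<infinity>\<close> this says that \<open>u\<close> and \<open>v\<close> lie in the same component of \<open>H\<close>.\<close>

definition can_move :: "enat \<Rightarrow> 'a pair_pre_digraph \<Rightarrow> 'a \<Rightarrow> 'a \<Rightarrow> bool" where
  "can_move r H u v \<longleftrightarrow> (\<exists>p. pre_digraph.apath (with_proj H) u p v \<and> enat (length p) \<le> r)"

definition isolated :: "'a pair_pre_digraph \<Rightarrow> 'a \<Rightarrow> bool" where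
  "isolated H v \<longleftrightarrow> v \<in> pverts H \<and> (\<forall>u. (u, v) \<notin> parcs H \<and> (v, u) \<notin> parcs H)"

text \<open>
  A strategy of the flipper maps the runner's positions \<open>[v\<^sub>0, \<dots>, v\<^sub>i\<^sub>-\<^sub>1]\<close> so far to the graph
  \<open>G\<^sub>i\<close> announced in round \<open>i \<ge> 1\<close>. The earlier announcements are determined by the strategy and
  these positions, so they need not be part of the history.
\<close>

type_synonym 'a flipper_strategy = "'a list \<Rightarrow> 'a pair_pre_digraph"

definition game_graph ::
  "'a pair_pre_digraph \<Rightarrow> 'a flipper_strategy \<Rightarrow> (nat \<Rightarrow> 'a) \<Rightarrow> nat \<Rightarrow> 'a pair_pre_digraph" where
  "game_graph G \<sigma> v i = (if i = 0 then G else \<sigma> (map v [0..<i]))"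

text \<open>
  The runner knows \<open>G\<^sub>i\<close> when moving to \<open>v\<^sub>i\<close>, but the path is taken in \<open>G\<^sub>i\<^sub>-\<^sub>1\<close>. As the strategy is
  fixed, quantifying over all legal sequences of positions accounts for this knowledge.
  Staying in place is legal, so every play extends to an infinite sequence.
\<close>

definition runner_play ::
  "enat \<Rightarrow> 'a pair_pre_digraph \<Rightarrow> 'a flipper_strategy \<Rightarrow> (nat \<Rightarrow> 'a) \<Rightarrow> bool" where
  "runner_play r G \<sigma> v \<longleftrightarrow>
     v 0 \<in> pverts G \<and> (\<forall>i\<ge>1. can_move r (game_graph G \<sigma> v (i - 1)) (v (i - 1)) (v i))"

definition winning_strategy ::
  "enat \<Rightarrow> nat \<Rightarrow> 'a pair_pre_digraph \<Rightarrow> 'a flipper_strategy \<Rightarrow> bool" where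
  "winning_strategy r k G \<sigma> \<longleftrightarrow>
     (\<forall>h. h \<noteq> [] \<and> set h \<subseteq> pverts G \<longrightarrow> is_k_flip k G (\<sigma> h)) \<and>
     (\<forall>v. runner_play r G \<sigma> v \<longrightarrow> (\<exists>i. isolated (game_graph G \<sigma> v i) (v i)))"

text \<open>An infimum in \<^typ>\<open>enat\<close>: the least such width, and \<open>\<infinity>\<close> if there is none.\<close>

definition flip_width :: "enat \<Rightarrow> 'a pair_pre_digraph \<Rightarrow> enat" where
  "flip_width r G = (INF k \<in> {k. \<exists>\<sigma>. winning_strategy r k G \<sigma>}. enat k)"

section \<open>Basic facts\<close>

lemma pverts_flip [simp]: "pverts (flip X G) = pverts G"
  by (simp add: flip_def split: prod.splits)

lemma comp_fun_commute_flip: "comp_fun_commute flip"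
proof (rule comp_fun_commute.intro, rule ext)
  fix X Y :: "'a set \<times> 'a set" and G :: "'a pair_pre_digraph"
  obtain A B C D where XY: "X = (A, B)" "Y = (C, D)"
    by (metis surj_pair)
  show "(flip Y \<circ> flip X) G = (flip X \<circ> flip Y) G"
    by (rule pair_pre_digraph.equality) (auto simp: XY flip_def)
qed

lemma flips_empty [simp]: "flips {} G = G"
  by (simp add: flips_def)

lemma flips_insert:
  assumes "finite S" "X \<notin> S"
  shows "flips (insert X S) G = flip X (flips S G)"
proof -
  interpret comp_fun_commute "flip :: 'a set \<times> 'a set \<Rightarrow> _"
    by (rule comp_fun_commute_flip)
  show ?thesis
    using assms by (simp add: flips_def)
qed

lemma pverts_flips [simp]: "finite S \<Longrightarrow> pverts (flips S G) = pverts G"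
  by (induction S rule: finite_induct) (auto simp: flips_insert)

lemma parcs_flips:
  assumes "pair_graph G" "finite S"
  shows "(u, v) \<in> parcs (flips S G) \<longleftrightarrow>
    u \<in> pverts G \<and> v \<in> pverts G \<and> u \<noteq> v \<and>
    ((u, v) \<in> parcs G) \<noteq> odd (card {(A, B) \<in> S. (u, v) \<in> A \<times> B \<union> B \<times> A})"
  using assms(2)
proof (induction S rule: finite_induct)
  case empty
  interpret pair_graph G by fact
  show ?case
    using in_arcsD1 in_arcsD2 no_loops' by (auto; blast)
next
  case (insert X S)
  obtain A B where X: "X = (A, B)" by fastforce
  let ?T = "\<lambda>S. {(A, B) \<in> S. (u, v) \<in> A \<times> B \<union> B \<times> A}"
  have eq: "?T (insert X S) = (if (u, v) \<in> A \<times> B \<union> B \<times> A then insert X (?T S) else ?T S)"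
    unfolding X by auto
  have "finite (?T S)"
    by (rule finite_subset[OF _ insert.hyps(1)]) auto
  moreover have "X \<notin> ?T S"
    using insert.hyps(2) by auto
  ultimately have "odd (card (?T (insert X S))) \<longleftrightarrow> odd (card (?T S)) \<noteq> ((u, v) \<in> A \<times> B \<union> B \<times> A)"
    unfolding eq by simp
  then show ?case
    using insert by (auto simp: flips_insert X flip_def)
qed

lemma contains_induced_iff:
  assumes "pair_graph G" "pair_graph H"
  shows "contains_induced G H \<longleftrightarrow>
    (\<exists>f. inj_on f (pverts H) \<and> f ` pverts H \<subseteq> pverts G \<and>
         (\<forall>u \<in> pverts H. \<forall>v \<in> pverts H. (f u, f v) \<in> parcs G \<longleftrightarrow> (u, v) \<in> parcs H))"
    (is "_ \<longleftrightarrow> (\<exists>f. ?emb f)")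
proof
  interpret G: pair_graph G by fact
  interpret H: pair_graph H by fact
  {
    assume "contains_induced G H"
    then obtain H' where ind: "induced_subgraph H' (with_proj G)"
      and iso: "digraph_iso H' (with_proj H)"
      by (auto simp: contains_induced_def)
    have sub: "verts H' \<subseteq> pverts G"
      and arcs: "arcs H' = {e \<in> parcs G. fst e \<in> verts H' \<and> snd e \<in> verts H'}"
      and wf: "wf_digraph H'" and ends: "tail H' = fst" "head H' = snd"
      using ind by (auto simp: induced_subgraph_def subgraph_def compatible_def)
    have "digraph_iso (with_proj H) H'"
      using digraph_iso_swap[OF wf iso] .
    then obtain h where h: "pre_digraph.digraph_isomorphism (with_proj H) h"
      and H': "H' = app_iso h (with_proj H)"
      by (auto simp: digraph_iso_def)
    let ?f = "iso_verts h"
    have V: "verts H' = ?f ` pverts H" and A: "arcs H' = iso_arcs h ` parcs H"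
      using H' by auto
    have ht: "iso_tail h = fst" "iso_head h = snd"
      using ends H' by auto
    have arc: "iso_arcs h e = (?f (fst e), ?f (snd e))" if "e \<in> parcs H" for e
      using h that by (auto simp: pre_digraph.digraph_isomorphism_def ht prod_eq_iff)
    have inj: "inj_on ?f (pverts H)"
      using h by (auto simp: pre_digraph.digraph_isomorphism_def)
    have "(?f u, ?f v) \<in> parcs G \<longleftrightarrow> (u, v) \<in> parcs H"
      if uv: "u \<in> pverts H" "v \<in> pverts H" for u v
    proof
      assume "(?f u, ?f v) \<in> parcs G"
      then have "(?f u, ?f v) \<in> arcs H'"
        using uv by (auto simp: arcs V)
      then obtain e where e: "e \<in> parcs H" "iso_arcs h e = (?f u, ?f v)"
        using A by auto
      then have "?f (fst e) = ?f u" "?f (snd e) = ?f v"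
        using arc by auto
      moreover have "fst e \<in> pverts H" "snd e \<in> pverts H"
        using e(1) H.arc_fst_in_verts H.arc_snd_in_verts by auto
      ultimately have "e = (u, v)"
        using inj uv by (auto simp: prod_eq_iff dest: inj_onD)
      then show "(u, v) \<in> parcs H"
        using e by simp
    next
      assume "(u, v) \<in> parcs H"
      then have "(?f u, ?f v) \<in> arcs H'"
        using arc A by force
      then show "(?f u, ?f v) \<in> parcs G"
        by (auto simp: arcs)
    qed
    then have "?emb ?f"
      using inj sub V by auto
    then show "\<exists>f. ?emb f" by (rule exI[of _ ?f])
  next
    assume "\<exists>f. ?emb f"
    then obtain f where f: "?emb f" by (elim exE)
    let ?H' = "with_proj G \<restriction> (f ` pverts H)"
    let ?h = "\<lparr>iso_verts = f, iso_arcs = map_prod f f, iso_head = snd, iso_tail = fst\<rparr>"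
    have ind: "induced_subgraph ?H' (with_proj G)"
      using f by (intro G.induced_induce) auto
    have V: "parcs H \<subseteq> pverts H \<times> pverts H"
      using H.in_arcsD1 H.in_arcsD2 by auto
    have "pre_digraph.digraph_isomorphism (with_proj H) ?h"
      using f H.wf_digraph V map_prod_inj_on[of f "pverts H" f "pverts H"]
      by (auto simp: pre_digraph.digraph_isomorphism_def intro: inj_on_subset)
    moreover have "?H' = app_iso ?h (with_proj H)"
    proof (rule pre_digraph.equality)
      show "arcs ?H' = arcs (app_iso ?h (with_proj H))"
      proof (intro set_eqI iffI)
        fix e assume "e \<in> arcs ?H'"
        then obtain u v where "e = (f u, f v)" "u \<in> pverts H" "v \<in> pverts H" "e \<in> parcs G"
          by (cases e) auto
        then show "e \<in> arcs (app_iso ?h (with_proj H))"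
          using f by force
      next
        fix e assume "e \<in> arcs (app_iso ?h (with_proj H))"
        then show "e \<in> arcs ?H'"
          using f V by fastforce
      qed
    qed auto
    ultimately have "digraph_iso (with_proj H) ?H'"
      by (auto simp: digraph_iso_def)
    then have "digraph_iso ?H' (with_proj H)"
      using digraph_iso_swap H.wf_digraph by blast
    then show "contains_induced G H"
      using ind by (auto simp: contains_induced_def)
  }
qed

lemma pair_graph_graph_of_edges:
  assumes "finite V" "E \<subseteq> V \<times> V" "irrefl E"
  shows "pair_graph (graph_of_edges V E)"
proof -
  have "finite E"
    using assms finite_subset by blast
  then show ?thesis
    using assms
    by unfold_locales (auto simp: graph_of_edges_def symmetric_def sym_def irrefl_def)
qed

lemma pair_graph_patterns: "pair_graph C5" "pair_graph bull" "pair_graph gem" "pair_graph co_gem"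
  unfolding C5_def bull_def gem_def co_gem_def
  by (rule pair_graph_graph_of_edges; auto simp: irrefl_def)+

end

(*
  The four forbidden graphs are exactly the switchings, in the sense of Seidel, of the graph P4 + K1.
  Let H be G switched at the neighbourhood of a vertex v. As v is isolated in H, an induced P4 of H
  would give an induced P4 + K1, so H is P4-free. Every switching of H, and the complement of every
  switching of H, is a 2-flip of G. If the runner is confined to a homogeneous set M of H, the
  P4-free graph H[M] splits into two parts A, B with all or no edges between them. A switching of H,
  or the complement of one if there are edges between A and B, detaches M from the rest and A from B.
  So the runner is confined to A or to B, which are again homogeneous in H, and this can be repeated
  until M is a single vertex.
*)

theory Submission
  imports Defs
begin

section \<open>Switchings and their complements as 2-flips\<close>

text \<open>Parts of a partition are disjoint, so at most one pair \<open>(A, A)\<close> covers a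
  given \<open>(u, w)\<close>, and the parity in \<open>parcs_flips\<close> reduces to
  existence.\<close>

lemma flips_same_part:
  assumes "pair_graph G" "partition_on (pverts G) P"
  shows "(u, w) \<in> parcs (flips ((\<lambda>A. (A, A)) ` P) G) \<longleftrightarrow>
    u \<in> pverts G \<and> w \<in> pverts G \<and> u \<noteq> w \<and>
    ((u, w) \<in> parcs G) \<noteq> (\<exists>A\<in>P. u \<in> A \<and> w \<in> A)"
proof -
  interpret pair_graph G by fact
  have fin: "finite P"
    by (rule finite_elements[OF _ assms(2)]) simp
  have eq: "{(A, B) \<in> (\<lambda>A. (A, A)) ` P. (u, w) \<in> A \<times> B \<union> B \<times> A} =
      (\<lambda>A. (A, A)) ` {A \<in> P. u \<in> A \<and> w \<in> A}"
    by auto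
  have "odd (card {A \<in> P. u \<in> A \<and> w \<in> A}) \<longleftrightarrow> (\<exists>A\<in>P. u \<in> A \<and> w \<in> A)"
  proof (cases "\<exists>A\<in>P. u \<in> A \<and> w \<in> A")
    case True
    then obtain A where A: "A \<in> P" "u \<in> A" "w \<in> A" by blast
    have "B = A" if "B \<in> P" "u \<in> B" for B
      using that A assms(2) by (auto simp: partition_on_def disjoint_def)
    then have "{A \<in> P. u \<in> A \<and> w \<in> A} = {A}"
      using A by blast
    then show ?thesis
      using True by simp
  next
    case False
    then have empty: "{A \<in> P. u \<in> A \<and> w \<in> A} = {}" by blast
    show ?thesis
      unfolding empty using False by simp
  qed
  then have "odd (card ((\<lambda>A. (A, A)) ` {A \<in> P. u \<in> A \<and> w \<in> A})) \<longleftrightarrow>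
      (\<exists>A\<in>P. u \<in> A \<and> w \<in> A)"
    by (subst card_image) (auto simp: inj_on_def)
  then show ?thesis
    using parcs_flips[OF assms(1), of "(\<lambda>A. (A, A)) ` P" u w] fin unfolding eq by simp
qed

text \<open>Toggling across the cut between \<open>X\<close> and the remaining vertices is the
  switching at \<open>X\<close>. Toggling inside both sides instead gives the complement of that
  switching; \<open>c\<close> selects between the two.\<close>

lemma ex_two_flip_switching:
  assumes "pair_graph G" "X \<subseteq> pverts G"
  obtains F where "is_k_flip 2 G F" "pverts F = pverts G"
    "\<And>u w. (u, w) \<in> parcs F \<longleftrightarrow> u \<in> pverts G \<and> w \<in> pverts G \<and> u \<noteq> w \<and>
       (((u, w) \<in> parcs G) \<noteq> ((u \<in> X) \<noteq> (w \<in> X))) \<noteq> c"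
proof -
  interpret pair_graph G by fact
  let ?V = "pverts G"
  let ?P = "{X, ?V - X} - {{}}"
  have P: "partition_on ?V ?P"
    using assms(2) by (auto simp: partition_on_def disjoint_def)
  have card: "card ?P \<le> 2"
    by (rule order.trans[OF card_mono[of "{X, ?V - X}"]]) (auto simp: card_insert_if)
  have G: "u \<in> ?V \<and> w \<in> ?V \<and> u \<noteq> w" if "(u, w) \<in> parcs G" for u w
    using that in_arcsD1 in_arcsD2 no_loops' by blast
  show thesis
  proof (cases c)
    case True
    let ?F = "flips ((\<lambda>A. (A, A)) ` ?P) G"
    show thesis
    proof (rule that[of ?F])
      show "is_k_flip 2 G ?F"
        unfolding is_k_flip_def
        by (intro exI[of _ ?P] exI[of _ "(\<lambda>A. (A, A)) ` ?P"] conjI P card refl) blast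
      show "pverts ?F = ?V" by simp
      fix u w
      have "(\<exists>A\<in>?P. u \<in> A \<and> w \<in> A) \<longleftrightarrow> (u \<in> X) = (w \<in> X)" if "u \<in> ?V" "w \<in> ?V"
        using that by blast
      then show "(u, w) \<in> parcs ?F \<longleftrightarrow> u \<in> ?V \<and> w \<in> ?V \<and> u \<noteq> w \<and>
          (((u, w) \<in> parcs G) \<noteq> ((u \<in> X) \<noteq> (w \<in> X))) \<noteq> c"
        unfolding flips_same_part[OF assms(1) P] using True by blast
    qed
  next
    case False
    \<comment> \<open>If one side of the cut is empty, it is not a part of \<open>?P\<close>; the
      switching is then trivial and the empty collection realises it.\<close>
    define S where "S = (if X = {} \<or> X = ?V then {} else {(X, ?V - X)})"
    have S: "S \<subseteq> ?P \<times> ?P" "finite S"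
      using assms(2) by (auto simp: S_def)
    show thesis
    proof (rule that[of "flips S G"])
      show "is_k_flip 2 G (flips S G)"
        unfolding is_k_flip_def
        by (intro exI[of _ ?P] exI[of _ S] conjI P card S refl)
      show "pverts (flips S G) = ?V"
        using S by simp
      show "(u, w) \<in> parcs (flips S G) \<longleftrightarrow> u \<in> ?V \<and> w \<in> ?V \<and> u \<noteq> w \<and>
          (((u, w) \<in> parcs G) \<noteq> ((u \<in> X) \<noteq> (w \<in> X))) \<noteq> c" for u w
        using False G[of u w] flips_insert[of "{}" "(X, ?V - X)" G]
        by (auto simp: S_def flip_def)
    qed
  qed
qed

section \<open>Winning by confining the runner\<close>

definition closed_in :: "'a pair_pre_digraph \<Rightarrow> 'a set \<Rightarrow> bool" where
  "closed_in F C \<longleftrightarrow> (\<forall>u w. u \<in> C \<longrightarrow> (u, w) \<in> parcs F \<longrightarrow> w \<in> C)"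

text \<open>No single arc of the path leaves \<open>C\<close>, so confinement holds for every
  radius, infinity included.\<close>

lemma can_move_closed_in:
  assumes "can_move r F u w" "closed_in F C" "u \<in> C"
  shows "w \<in> C"
proof -
  obtain p where "pre_digraph.apath (with_proj F) u p w"
    using assms(1) by (auto simp: can_move_def)
  then have "pre_digraph.cas (with_proj F) u p w" "set p \<subseteq> parcs F"
    by (auto simp: pre_digraph.apath_def pre_digraph.awalk_def)
  then show ?thesis
    using assms(3)
  proof (induction p arbitrary: u)
    case Nil
    then show ?case by (simp add: pre_digraph.cas.simps)
  next
    case (Cons e p)
    then have "fst e = u" "e \<in> parcs F" "pre_digraph.cas (with_proj F) (snd e) p w"
      by (auto simp: pre_digraph.cas.simps)
    then show ?case
      using Cons assms(2) by (metis closed_in_def insert_subset list.simps(15) prod.collapse)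
  qed
qed

text \<open>The confining set shrinks strictly as long as the runner is not isolated, which cannot
  go on forever in a finite graph. In \<open>Q_step\<close> the flip \<open>F\<close> is chosen
  before \<open>w\<close>, since the flipper announces it before the runner moves, while
  \<open>C\<close> may depend on \<open>w\<close>.\<close>

lemma winning_strategy_by_confinement:
  fixes G :: "'a pair_pre_digraph"
  assumes "finite (pverts G)" and Q_verts: "Q (pverts G)"
    and G: "closed_in G (pverts G)"
    and Q_step: "\<And>M. Q M \<Longrightarrow> \<exists>F. is_k_flip k G F \<and>
      (\<forall>w\<in>M. isolated F w \<or> (\<exists>C. Q C \<and> w \<in> C \<and> C \<subset> M \<and> closed_in F C))"
  shows "\<exists>\<sigma>. winning_strategy r k G \<sigma>"
proof -
  let ?good = "\<lambda>M F. is_k_flip k G F \<and>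
    (\<forall>w\<in>M. isolated F w \<or> (\<exists>C. Q C \<and> w \<in> C \<and> C \<subset> M \<and> closed_in F C))"
  define F where "F M = (SOME F. ?good M F)" for M
  have "?good M (F M)" if "Q M" for M
    unfolding F_def using someI_ex[OF Q_step[OF that]] .
  then have F: "is_k_flip k G (F M)"
    "\<And>w. w \<in> M \<Longrightarrow> isolated (F M) w \<or> (\<exists>C. Q C \<and> w \<in> C \<and> C \<subset> M \<and> closed_in (F M) C)"
    if "Q M" for M
    using that by simp_all
  \<comment> \<open>The default \<open>M\<close> preserves \<open>Q\<close> on histories that are
    not legal plays or continue after a win; a strategy must announce a k-flip on these too.\<close>
  define C where "C M w = (if \<exists>C. Q C \<and> w \<in> C \<and> C \<subset> M \<and> closed_in (F M) C
    then SOME C. Q C \<and> w \<in> C \<and> C \<subset> M \<and> closed_in (F M) C else M)" for M w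
  have C: "Q (C M w) \<and> w \<in> C M w \<and> C M w \<subset> M \<and> closed_in (F M) (C M w)"
    if "Q M" "w \<in> M" "\<not> isolated (F M) w" for M w
  proof -
    have ex: "\<exists>C. Q C \<and> w \<in> C \<and> C \<subset> M \<and> closed_in (F M) C"
      using F(2) that by blast
    show ?thesis
      unfolding C_def if_P[OF ex] using someI_ex[OF ex] .
  qed
  have Q_C: "Q (C M w)" if "Q M" for M w
  proof (cases "\<exists>C. Q C \<and> w \<in> C \<and> C \<subset> M \<and> closed_in (F M) C")
    case True
    show ?thesis
      unfolding C_def if_P[OF True] using someI_ex[OF True] by blast
  next
    case False
    then show ?thesis
      using that unfolding C_def by auto
  qed
  have Q_foldl: "Q (foldl C M h)" if "Q M" for M h
    using that by (induction h arbitrary: M) (auto intro: Q_C)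
  \<comment> \<open>The starting vertex is dropped: the first move takes place in \<open>G\<close>
    itself, where only the whole vertex set is known to confine the runner.\<close>
  define \<sigma> where "\<sigma> h = F (foldl C (pverts G) (tl h))" for h
  have "\<exists>i. isolated (game_graph G \<sigma> v i) (v i)" if play: "runner_play r G \<sigma> v" for v
  proof (rule ccontr)
    assume not_isolated: "\<nexists>i. isolated (game_graph G \<sigma> v i) (v i)"
    \<comment> \<open>\<open>c i\<close> is the confining set once \<open>v i\<close> is known. It
      is closed in the graph of round \<open>i\<close> and determines the graph of round
      \<open>i + 1\<close>.\<close>
    define c where "c i = foldl C (pverts G) (map v [1..<Suc i])" for i
    have c_Suc: "c (Suc i) = C (c i) (v (Suc i))" for i
      by (simp add: c_def)
    have Q_c: "Q (c i)" for i
      by (simp add: c_def Q_foldl Q_verts)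
    have graph_Suc: "game_graph G \<sigma> v (Suc i) = F (c i)" for i
    proof -
      have "tl (map v [0..<Suc i]) = map v [1..<Suc i]"
        by (simp add: upt_conv_Cons del: upt_Suc)
      then show ?thesis
        by (simp add: game_graph_def \<sigma>_def c_def del: upt_Suc)
    qed
    \<comment> \<open>Each round costs at least one vertex of the confining set, so the bound fails
      after \<open>card (pverts G) + 1\<close> rounds.\<close>
    have "v i \<in> c i \<and> closed_in (game_graph G \<sigma> v i) (c i) \<and> finite (c i) \<and>
        card (c i) + i \<le> card (pverts G)" for i
    proof (induction i)
      case 0
      then show ?case
        using play G assms(1) by (simp add: runner_play_def c_def game_graph_def)
    next
      case (Suc i)
      have "can_move r (game_graph G \<sigma> v i) (v i) (v (Suc i))"
        using play unfolding runner_play_def by (metis diff_Suc_1 le_add1 plus_1_eq_Suc)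
      then have "v (Suc i) \<in> c i"
        by (rule can_move_closed_in) (use Suc in simp_all)
      then have *: "v (Suc i) \<in> c (Suc i) \<and> c (Suc i) \<subset> c i \<and> closed_in (F (c i)) (c (Suc i))"
        using C[OF Q_c, of "v (Suc i)" i] not_isolated graph_Suc unfolding c_Suc by metis
      then have "card (c (Suc i)) < card (c i)"
        using Suc by (simp add: psubset_card_mono)
      then show ?case
        using * Suc finite_subset[of "c (Suc i)" "c i"] by (auto simp: graph_Suc)
    qed
    from this[of "Suc (card (pverts G))"] show False by simp
  qed
  then have "winning_strategy r k G \<sigma>"
    by (simp add: winning_strategy_def \<sigma>_def F(1) Q_foldl Q_verts)
  then show ?thesis by blast
qed

section \<open>Decomposition of P4-free graphs\<close>

text \<open>Distinctness keeps the diagonal out of play, so that the negation of \<open>E\<close>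
  can serve as the complement graph although it may be reflexive.\<close>

definition P4_free_on :: "'a set \<Rightarrow> ('a \<Rightarrow> 'a \<Rightarrow> bool) \<Rightarrow> bool" where
  "P4_free_on M E \<longleftrightarrow> (\<forall>a\<in>M. \<forall>b\<in>M. \<forall>c\<in>M. \<forall>d\<in>M. distinct [a, b, c, d] \<longrightarrow>
     \<not> (E a b \<and> E b c \<and> E c d \<and> \<not> E a c \<and> \<not> E b d \<and> \<not> E a d))"

text \<open>P4 is self-complementary: a path \<open>a b c d\<close> in the complement is the path
  \<open>b d a c\<close> in \<open>E\<close>.\<close>

lemma P4_free_on_complement:
  assumes "P4_free_on M E" "symp E"
  shows "P4_free_on M (\<lambda>u w. \<not> E u w)"
  unfolding P4_free_on_def
proof (intro ballI impI notI)
  fix a b c d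
  assume "a \<in> M" "b \<in> M" "c \<in> M" "d \<in> M" "distinct [a, b, c, d]"
    and "\<not> E a b \<and> \<not> E b c \<and> \<not> E c d \<and> \<not> \<not> E a c \<and> \<not> \<not> E b d \<and> \<not> \<not> E a d"
  then show False
    using assms(1)[unfolded P4_free_on_def, rule_format, of b d a c] sympD[OF assms(2)]
    by (metis distinct_length_2_or_more distinct_singleton)
qed

text \<open>A disjoint union for \<open>c\<close> false and a join for \<open>c\<close> true, the
  two operations that build cographs.\<close>

definition splits :: "('a \<Rightarrow> 'a \<Rightarrow> bool) \<Rightarrow> 'a set \<Rightarrow> 'a set \<Rightarrow> 'a set \<Rightarrow> bool \<Rightarrow> bool" where
  "splits E M A B c \<longleftrightarrow> A \<noteq> {} \<and> B \<noteq> {} \<and> A \<inter> B = {} \<and> A \<union> B = M \<and> (\<forall>a\<in>A. \<forall>b\<in>B. E a b = c)"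

lemma splits_commute:
  assumes "splits E M A B c" "symp E"
  shows "splits E M B A c"
proof -
  have "E b a = E a b" for a b
    using sympD[OF assms(2)] by blast
  then have "\<forall>b\<in>B. \<forall>a\<in>A. E b a = c"
    using assms(1) unfolding splits_def by metis
  then show ?thesis
    using assms(1) by (simp add: splits_def Int_commute Un_commute)
qed

text \<open>If \<open>x\<close> has no neighbour in one part, it joins the other part; if it sees
  all of \<open>M\<close>, it is split off by a join. Otherwise its non-neighbours are cut off from
  \<open>x\<close> and its neighbours.\<close>

lemma splits_insert:
  assumes free: "P4_free_on (insert x M) E" and E: "symp E" and x: "x \<notin> M"
    and split: "splits E M A B False"
  shows "\<exists>A' B' c. splits E (insert x M) A' B' c"
proof -
  let ?N = "{u \<in> M. E x u}"
  note sym = sympD[OF E]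
  consider "A \<inter> ?N = {}" | "B \<inter> ?N = {}" | "M \<subseteq> ?N"
    | "A \<inter> ?N \<noteq> {}" "B \<inter> ?N \<noteq> {}" "\<not> M \<subseteq> ?N" by blast
  then show ?thesis
  proof cases
    case 1
    then have "splits E (insert x M) A (insert x B) False"
      using split x sym by (auto simp: splits_def)
    then show ?thesis by blast
  next
    case 2
    then have "splits E (insert x M) (insert x A) B False"
      using split x sym by (auto simp: splits_def)
    then show ?thesis by blast
  next
    case 3
    then have "splits E (insert x M) {x} M True"
      using split x by (auto simp: splits_def)
    then show ?thesis by blast
  next
    case 4
    \<comment> \<open>Here \<open>u w x z\<close> would be an induced P4. Below, \<open>z\<close> is
      a neighbour of \<open>x\<close> in the part that does not contain the edge from
      \<open>u\<close> to \<open>w\<close>.\<close>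
    have no: False if "u \<in> M - ?N" "w \<in> ?N" "z \<in> ?N" "E u w" "\<not> E w z" "\<not> E u z" for u w z
    proof -
      have "distinct [u, w, x, z]"
        using that x by auto
      then show False
        using that free[unfolded P4_free_on_def, rule_format, of u w x z] sym by auto
    qed
    have "\<not> E u w" if uw: "u \<in> M - ?N" "w \<in> ?N" for u w
    proof
      assume "E u w"
      obtain a b where ab: "a \<in> A \<inter> ?N" "b \<in> B \<inter> ?N"
        using 4 by blast
      have M: "M = A \<union> B" and AB: "\<And>s t. s \<in> A \<Longrightarrow> t \<in> B \<Longrightarrow> \<not> E s t \<and> \<not> E t s"
        using split splits_commute[OF split E] by (simp_all add: splits_def)
      show False
      proof (cases "u \<in> A")
        case True
        then have "w \<in> A"
          using uw M AB \<open>E u w\<close> by blast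
        then show False
          using no[of u w b] uw ab AB True \<open>E u w\<close> by blast
      next
        case False
        then have "u \<in> B" "w \<in> B"
          using uw M AB \<open>E u w\<close> by blast+
        then show False
          using no[of u w a] uw ab AB \<open>E u w\<close> by blast
      qed
    qed
    moreover have "\<not> E u x" if "u \<in> M - ?N" for u
      using that sym[of u x] by blast
    ultimately have "splits E (insert x M) (M - ?N) (insert x ?N) False"
      using 4 x unfolding splits_def by blast
    then show ?thesis by blast
  qed
qed

text \<open>Seinsche's theorem, by adding one vertex at a time. If the smaller graph is a join, its
  complement is a disjoint union and still P4-free, so \<open>splits_insert\<close> applies
  there.\<close>

lemma P4_free_splits:
  assumes "finite M" "2 \<le> card M" "P4_free_on M E" "symp E"
  shows "\<exists>A B c. splits E M A B c"
  using assms(1-3)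
proof (induction M rule: finite_induct)
  case empty
  then show ?case by simp
next
  case (insert x M)
  have mono: "P4_free_on M E"
    using insert.prems(2) unfolding P4_free_on_def by blast
  show ?case
  proof (cases "card M = 1")
    case True
    then obtain y where "M = {y}"
      by (auto simp: card_1_singleton_iff)
    then have "splits E (insert x M) {x} {y} (E x y)"
      using insert.hyps by (auto simp: splits_def)
    then show ?thesis by blast
  next
    case False
    then have "2 \<le> card M"
      using insert by auto
    then obtain A B c where AB: "splits E M A B c"
      using insert.IH mono by blast
    show ?thesis
    proof (cases c)
      case False
      then show ?thesis
        using splits_insert[OF insert.prems(2) assms(4) insert.hyps(2)] AB by simp
    next
      case True
      let ?E = "\<lambda>u w. \<not> E u w"
      have "splits ?E M A B False"
        using AB True by (auto simp: splits_def)
      then obtain A' B' c' where "splits ?E (insert x M) A' B' c'"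
        using splits_insert[OF P4_free_on_complement[OF insert.prems(2) assms(4)] _ insert.hyps(2)]
          sympD[OF assms(4)] by (metis sympI)
      then have "splits E (insert x M) A' B' (\<not> c')"
        by (auto simp: splits_def)
      then show ?thesis by blast
    qed
  qed
qed

section \<open>Homogeneous sets and one round of the flipper\<close>

text \<open>These are the modules of modular decomposition.\<close>

definition homogeneous :: "('a \<Rightarrow> 'a \<Rightarrow> bool) \<Rightarrow> 'a set \<Rightarrow> 'a set \<Rightarrow> bool" where
  "homogeneous E V M \<longleftrightarrow> M \<subseteq> V \<and> (\<forall>x\<in>V - M. \<forall>u\<in>M. \<forall>w\<in>M. E u x = E w x)"

text \<open>Vertices of \<open>B\<close> relate to \<open>A\<close> uniformly by the value
  \<open>c\<close>, and vertices outside \<open>M\<close> relate uniformly even to all of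
  \<open>M\<close>.\<close>

lemma homogeneous_splits:
  assumes "homogeneous E V M" "splits E M A B c"
  shows "homogeneous E V A"
proof -
  have AB: "M = A \<union> B" "\<And>a b. a \<in> A \<Longrightarrow> b \<in> B \<Longrightarrow> E a b = c"
    using assms(2) by (auto simp: splits_def)
  have M: "M \<subseteq> V" "\<And>x u w. x \<in> V - M \<Longrightarrow> u \<in> M \<Longrightarrow> w \<in> M \<Longrightarrow> E u x = E w x"
    using assms(1) unfolding homogeneous_def by blast+
  have "E u x = E w x" if "x \<in> V - A" "u \<in> A" "w \<in> A" for x u w
  proof (cases "x \<in> B")
    case True
    then show ?thesis using AB that by simp
  next
    case False
    then show ?thesis using AB(1) that M(2)[of x u w] by blast
  qed
  then show ?thesis
    using M(1) AB(1) unfolding homogeneous_def by blast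
qed

text \<open>
  A switching that removes the edges between \<open>M\<close> and the rest acts trivially inside \<open>M\<close>; it is
  combined with complementation according to \<open>c\<close>.
\<close>

lemma ex_two_flip_separating:
  assumes G: "pair_graph G" and E: "symp E" and X: "X \<subseteq> pverts G"
    and arcs: "\<And>u w. E u w \<longleftrightarrow> ((u, w) \<in> parcs G) \<noteq> ((u \<in> X) \<noteq> (w \<in> X))"
    and M: "homogeneous E (pverts G) M"
  obtains F where "is_k_flip 2 G F" "pverts F = pverts G"
    "\<And>u w. u \<in> M \<Longrightarrow> (u, w) \<in> parcs F \<Longrightarrow> w \<in> M \<and> u \<noteq> w \<and> E u w \<noteq> c"
    "\<And>u w. u \<in> M \<Longrightarrow> (w, u) \<in> parcs F \<Longrightarrow> w \<in> M \<and> u \<noteq> w \<and> E u w \<noteq> c"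
proof -
  let ?V = "pverts G"
  \<comment> \<open>By homogeneity each outside vertex disagrees with \<open>c\<close> on all of
    \<open>M\<close> or on none of it. Switching at \<open>N\<close> makes every adjacency between
    \<open>M\<close> and the rest equal to \<open>c\<close>, and adding \<open>c\<close> then erases
    these edges.\<close>
  define N where "N = {x \<in> ?V - M. \<exists>u\<in>M. E u x \<noteq> c}"
  \<comment> \<open>Switchings compose by symmetric difference: switching \<open>E\<close> at
    \<open>N\<close> is switching \<open>G\<close> at \<open>Y\<close>, hence a single 2-flip of
    \<open>G\<close>.\<close>
  define Y where "Y = (X - N) \<union> (N - X)"
  have "Y \<subseteq> ?V"
    using X by (auto simp: Y_def N_def)
  from ex_two_flip_switching[OF G this, of c]
  obtain F where F: "is_k_flip 2 G F" "pverts F = ?V" and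
    parcs: "\<And>u w. (u, w) \<in> parcs F \<longleftrightarrow> u \<in> ?V \<and> w \<in> ?V \<and> u \<noteq> w \<and>
       (((u, w) \<in> parcs G) \<noteq> ((u \<in> Y) \<noteq> (w \<in> Y))) \<noteq> c" by metis
  have parcs_F: "(u, w) \<in> parcs F \<longleftrightarrow> u \<in> ?V \<and> w \<in> ?V \<and> u \<noteq> w \<and>
      (E u w \<noteq> c) \<noteq> ((u \<in> N) \<noteq> (w \<in> N))" for u w
    unfolding parcs Y_def using arcs[of u w] by blast
  have MN: "x \<in> N \<longleftrightarrow> E u x \<noteq> c" if "u \<in> M" "x \<in> ?V - M" for u x
    using that M unfolding N_def homogeneous_def by blast
  have out: "w \<in> M \<and> u \<noteq> w \<and> E u w \<noteq> c" if "u \<in> M" "(u, w) \<in> parcs F" for u w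
    using that MN[of u w] unfolding parcs_F N_def by blast
  have swap: "(u, w) \<in> parcs F" if "(w, u) \<in> parcs F" for u w
    using that sympD[OF E] unfolding parcs_F by blast
  show thesis
    using that[OF F] out swap by blast
qed

text \<open>Taking for \<open>c\<close> the value of the split removes the edges between
  \<open>A\<close> and \<open>B\<close> together with those leaving \<open>M\<close>. A set
  \<open>M\<close> with at most one vertex is isolated by the same flip, as it has no inner
  edges.\<close>

lemma switching_step:
  assumes G: "pair_graph G" and E: "symp E" and X: "X \<subseteq> pverts G"
    and arcs: "\<And>u w. E u w \<longleftrightarrow> ((u, w) \<in> parcs G) \<noteq> ((u \<in> X) \<noteq> (w \<in> X))"
    and free: "P4_free_on (pverts G) E"
    and M: "homogeneous E (pverts G) M"
  shows "\<exists>F. is_k_flip 2 G F \<and> (\<forall>w\<in>M. isolated F w \<or>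
    (\<exists>C. homogeneous E (pverts G) C \<and> w \<in> C \<and> C \<subset> M \<and> closed_in F C))"
proof -
  interpret pair_graph G by fact
  have MV: "M \<subseteq> pverts G"
    using M by (simp add: homogeneous_def)
  then have fin: "finite M"
    by (rule finite_subset) simp
  show ?thesis
  proof (cases "2 \<le> card M")
    case True
    have "P4_free_on M E"
      using free MV unfolding P4_free_on_def by blast
    then obtain A B c where AB: "splits E M A B c"
      using P4_free_splits[OF fin True _ E] by blast
    obtain F where F: "is_k_flip 2 G F"
      "\<And>u w. u \<in> M \<Longrightarrow> (u, w) \<in> parcs F \<Longrightarrow> w \<in> M \<and> u \<noteq> w \<and> E u w \<noteq> c"
      by (rule ex_two_flip_separating[OF G E X arcs M, of c]) (rule that; assumption)
    have part: "\<exists>C. homogeneous E (pverts G) C \<and> w \<in> C \<and> C \<subset> M \<and> closed_in F C"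
      if AB: "splits E M A B c" and w: "w \<in> A" for A B w
    proof (intro exI conjI)
      show "homogeneous E (pverts G) A"
        using homogeneous_splits[OF M AB] .
      show "w \<in> A" by fact
      have parts: "B \<noteq> {}" "A \<inter> B = {}" "M = A \<union> B"
        and split: "\<And>a b. a \<in> A \<Longrightarrow> b \<in> B \<Longrightarrow> E a b = c"
        using AB by (simp_all add: splits_def)
      show "A \<subset> M"
        using parts by blast
      show "closed_in F A"
        unfolding closed_in_def
      proof (intro allI impI)
        fix u u'
        assume "u \<in> A" "(u, u') \<in> parcs F"
        then show "u' \<in> A"
          using F(2)[of u u'] split[of u u'] parts(3) by auto
      qed
    qed
    have "\<exists>C. homogeneous E (pverts G) C \<and> w \<in> C \<and> C \<subset> M \<and> closed_in F C" if "w \<in> M" for w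
    proof -
      have "w \<in> A \<or> w \<in> B"
        using AB that by (auto simp: splits_def)
      then show ?thesis
        using part[OF AB] part[OF splits_commute[OF AB E]] by metis
    qed
    then show ?thesis
      using F(1) by blast
  next
    case False
    have eq: "u = w" if "u \<in> M" "w \<in> M" for u w
      using False card_mono[OF fin, of "{u, w}"] that by (cases "u = w") auto
    \<comment> \<open>The value \<open>True\<close> is an arbitrary choice: the flag only affects
      pairs inside \<open>M\<close>, and there are none.\<close>
    obtain F where F: "is_k_flip 2 G F" "pverts F = pverts G"
      "\<And>u w. u \<in> M \<Longrightarrow> (u, w) \<in> parcs F \<Longrightarrow> w \<in> M \<and> u \<noteq> w \<and> E u w \<noteq> True"
      "\<And>u w. u \<in> M \<Longrightarrow> (w, u) \<in> parcs F \<Longrightarrow> w \<in> M \<and> u \<noteq> w \<and> E u w \<noteq> True"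
      by (rule ex_two_flip_separating[OF G E X arcs M, of True]) (rule that; assumption)
    have "isolated F w" if "w \<in> M" for w
      unfolding isolated_def using that F(2) F(3)[of w] F(4)[of w] eq[of w] MV by blast
    then show ?thesis
      using F(1) by blast
  qed
qed

section \<open>The forbidden subgraphs and the switching at a vertex\<close>

lemma contains_induced_five:
  assumes G: "pair_graph G" and H: "pair_graph (graph_of_edges {0,1,2,3,4} E)"
    and xs: "length xs = 5" "distinct xs" "set xs \<subseteq> pverts G"
    and arcs: "\<And>i j. j < i \<Longrightarrow> i < 5 \<Longrightarrow>
      (xs ! i, xs ! j) \<in> parcs G \<longleftrightarrow> (i, j) \<in> E \<or> (j, i) \<in> E"
  shows "contains_induced G (graph_of_edges {0,1,2,3,4::nat} E)"
proof -
  interpret G: pair_graph G by fact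
  interpret H: pair_graph "graph_of_edges {0,1,2,3,4} E" by fact
  have five: "pverts (graph_of_edges {0,1,2,3,4::nat} E) = {..<5}"
    by (auto simp: graph_of_edges_def)
  have irrefl: "(i, i) \<notin> E" for i
    using H.no_loops'[of i i] by (auto simp: graph_of_edges_def)
  have sym: "(u, w) \<in> parcs G \<longleftrightarrow> (w, u) \<in> parcs G" for u w
    using G.arcs_symmetric by auto
  have "(xs ! i, xs ! j) \<in> parcs G \<longleftrightarrow> (i, j) \<in> E \<or> (j, i) \<in> E" if "i < 5" "j < 5" for i j
    using that arcs[of i j] arcs[of j i] sym irrefl[of i] G.no_loops'
    by (cases i j rule: linorder_cases) auto
  moreover have "inj_on ((!) xs) {..<5}"
    using xs by (simp add: inj_on_def nth_eq_iff_index_eq)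
  ultimately show ?thesis
    unfolding contains_induced_iff[OF G H] five
    using xs by (intro exI[of _ "(!) xs"]) (auto simp: graph_of_edges_def)
qed

lemma all_less_numeral:
  fixes Q :: "nat \<Rightarrow> bool"
  shows "(\<forall>i<5. Q i) \<longleftrightarrow> Q 0 \<and> Q 1 \<and> Q 2 \<and> Q 3 \<and> Q 4"
    "(\<forall>i<4. Q i) \<longleftrightarrow> Q 0 \<and> Q 1 \<and> Q 2 \<and> Q 3"
    "(\<forall>i<3. Q i) \<longleftrightarrow> Q 0 \<and> Q 1 \<and> Q 2"
    "(\<forall>i<2. Q i) \<longleftrightarrow> Q 0 \<and> Q 1"
  by (auto simp: numeral_eq_Suc less_Suc_eq)

text \<open>Explicit tuples allow instantiation with named vertices, and \<open>j < i\<close> lists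
  each unordered pair once. With \<open>all_less_numeral\<close> this unrolls into ten adjacency
  conditions.\<close>

definition no_pattern :: "'a pair_pre_digraph \<Rightarrow> nat rel \<Rightarrow> bool" where
  "no_pattern G E \<longleftrightarrow> (\<forall>a b c d e. {a, b, c, d, e} \<subseteq> pverts G \<and> distinct [a, b, c, d, e] \<longrightarrow>
     \<not> (\<forall>i<5. \<forall>j<i. ([a, b, c, d, e] ! i, [a, b, c, d, e] ! j) \<in> parcs G \<longleftrightarrow>
       (i, j) \<in> E \<or> (j, i) \<in> E))"

lemma no_patternI:
  assumes "pair_graph G" "pair_graph (graph_of_edges {0,1,2,3,4} E)"
    "\<not> contains_induced G (graph_of_edges {0,1,2,3,4} E)"
  shows "no_pattern G E"
  unfolding no_pattern_def
proof (intro allI impI notI, elim conjE)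
  fix a b c d e
  assume "{a, b, c, d, e} \<subseteq> pverts G" "distinct [a, b, c, d, e]"
    "\<forall>i<5. \<forall>j<i. ([a, b, c, d, e] ! i, [a, b, c, d, e] ! j) \<in> parcs G \<longleftrightarrow>
       (i, j) \<in> E \<or> (j, i) \<in> E"
  then have "contains_induced G (graph_of_edges {0,1,2,3,4} E)"
    by (intro contains_induced_five[where xs = "[a, b, c, d, e]", OF assms(1,2)]) auto
  then show False
    using assms(3) by contradiction
qed

lemma switching_at_vertex_P4_free:
  fixes G :: "'a pair_pre_digraph" and v :: 'a
  assumes G: "pair_graph G" and v: "v \<in> pverts G"
    and C5: "\<not> contains_induced G C5" and bull: "\<not> contains_induced G bull"
    and gem: "\<not> contains_induced G gem" and co_gem: "\<not> contains_induced G co_gem"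
  shows "P4_free_on (pverts G)
    (\<lambda>u w. ((u, w) \<in> parcs G) \<noteq> (((v, u) \<in> parcs G) \<noteq> ((v, w) \<in> parcs G)))"
    (is "P4_free_on _ ?E")
  unfolding P4_free_on_def
proof (intro ballI impI notI)
  interpret pair_graph G by fact
  fix a b c d
  assume V: "a \<in> pverts G" "b \<in> pverts G" "c \<in> pverts G" "d \<in> pverts G"
    and dist: "distinct [a, b, c, d]"
    and P4: "?E a b \<and> ?E b c \<and> ?E c d \<and> \<not> ?E a c \<and> \<not> ?E b d \<and> \<not> ?E a d"
  have sym: "(u, w) \<in> parcs G \<longleftrightarrow> (w, u) \<in> parcs G" for u w
    using arcs_symmetric by auto
  have "(v, v) \<notin> parcs G"
    using no_loops' by blast
  \<comment> \<open>\<open>v\<close> is isolated in the switched graph, whereas each vertex of the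
    path has a neighbour there.\<close>
  then have "v \<noteq> a" "v \<noteq> b" "v \<noteq> c" "v \<noteq> d"
    using P4 sym by blast+
  then have neq: "a \<noteq> b" "b \<noteq> a" "a \<noteq> c" "c \<noteq> a" "a \<noteq> d" "d \<noteq> a" "b \<noteq> c" "c \<noteq> b" "b \<noteq> d" "d \<noteq> b"
    "c \<noteq> d" "d \<noteq> c" "v \<noteq> a" "a \<noteq> v" "v \<noteq> b" "b \<noteq> v" "v \<noteq> c" "c \<noteq> v" "v \<noteq> d" "d \<noteq> v"
    using dist by auto
  let ?v = "\<lambda>u. (v, u) \<in> parcs G"
  \<comment> \<open>Undoing the switching expresses all adjacencies of the five vertices in
    \<open>G\<close> by four truth values, which leaves sixteen cases.\<close>
  have arcs: "(a, b) \<in> parcs G \<longleftrightarrow> ?v a = ?v b" "(b, a) \<in> parcs G \<longleftrightarrow> ?v a = ?v b"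
    "(b, c) \<in> parcs G \<longleftrightarrow> ?v b = ?v c" "(c, b) \<in> parcs G \<longleftrightarrow> ?v b = ?v c"
    "(c, d) \<in> parcs G \<longleftrightarrow> ?v c = ?v d" "(d, c) \<in> parcs G \<longleftrightarrow> ?v c = ?v d"
    "(a, c) \<in> parcs G \<longleftrightarrow> ?v a \<noteq> ?v c" "(c, a) \<in> parcs G \<longleftrightarrow> ?v a \<noteq> ?v c"
    "(b, d) \<in> parcs G \<longleftrightarrow> ?v b \<noteq> ?v d" "(d, b) \<in> parcs G \<longleftrightarrow> ?v b \<noteq> ?v d"
    "(a, d) \<in> parcs G \<longleftrightarrow> ?v a \<noteq> ?v d" "(d, a) \<in> parcs G \<longleftrightarrow> ?v a \<noteq> ?v d"
    "(a, v) \<in> parcs G \<longleftrightarrow> ?v a" "(b, v) \<in> parcs G \<longleftrightarrow> ?v b"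
    "(c, v) \<in> parcs G \<longleftrightarrow> ?v c" "(d, v) \<in> parcs G \<longleftrightarrow> ?v d"
    using P4 sym by blast+
  note pats = pair_graph_patterns[unfolded C5_def bull_def gem_def co_gem_def]
  note no_C5 = no_patternI[OF G pats(1) C5[unfolded C5_def],
      unfolded no_pattern_def all_less_numeral, simplified, rule_format]
  note no_bull = no_patternI[OF G pats(2) bull[unfolded bull_def],
      unfolded no_pattern_def all_less_numeral, simplified, rule_format]
  note no_gem = no_patternI[OF G pats(3) gem[unfolded gem_def],
      unfolded no_pattern_def all_less_numeral, simplified, rule_format]
  note no_co_gem = no_patternI[OF G pats(4) co_gem[unfolded co_gem_def],
      unfolded no_pattern_def all_less_numeral, simplified, rule_format]
  \<comment> \<open>one instance for each possible set of neighbours of \<open>v\<close> on the path \<open>a b c d\<close>\<close>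
  show False
    using no_co_gem[of a b c d v] no_bull[of b c a v d] no_co_gem[of c d b v a]
      no_gem[of c d b v a] no_co_gem[of b a c v d] no_co_gem[of c v a d b]
      no_bull[of a c b d v] no_gem[of c v a d b] no_bull[of c b d v a] no_C5[of a c b d v]
      no_co_gem[of a d v b c] no_bull[of c a v d b] no_gem[of b a c v d]
      no_bull[of a v d b c] no_gem[of a d v b c] no_gem[of a b c d v] V v
    by (cases "?v a"; cases "?v b"; cases "?v c"; cases "?v d") (simp_all add: arcs neq)
qed

section \<open>The bound on the flip-width\<close>

theorem theorem4p2:
  fixes G :: "'a pair_pre_digraph" and r :: enat
  assumes "pair_graph G"
    and "\<not> contains_induced G C5"
    and "\<not> contains_induced G bull"
    and "\<not> contains_induced G gem"
    and "\<not> contains_induced G co_gem"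
    and "r \<ge> 1"
  shows "flip_width r G \<le> 2"
proof -
  interpret pair_graph G by fact
  have "\<exists>\<sigma>. winning_strategy r 2 G \<sigma>"
  \<comment> \<open>Without vertices there is no play and no nonempty history, so every strategy
    wins; otherwise any vertex can serve as \<open>v\<close>.\<close>
  proof (cases "pverts G = {}")
    case True
    then show ?thesis
      by (auto simp: winning_strategy_def runner_play_def)
  next
    case False
    then obtain v where v: "v \<in> pverts G" by blast
    define X where "X = {u. (v, u) \<in> parcs G}"
    define E where "E u w \<longleftrightarrow> ((u, w) \<in> parcs G) \<noteq> ((u \<in> X) \<noteq> (w \<in> X))" for u w
    have X: "X \<subseteq> pverts G"
      using in_arcsD2 by (auto simp: X_def)
    have sym: "symp E"
      unfolding E_def using arcs_symmetric by (intro sympI) blast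
    have "E = (\<lambda>u w. ((u, w) \<in> parcs G) \<noteq> (((v, u) \<in> parcs G) \<noteq> ((v, w) \<in> parcs G)))"
      by (simp add: fun_eq_iff E_def X_def)
    then have free: "P4_free_on (pverts G) E"
      using switching_at_vertex_P4_free[OF assms(1) v assms(2-5)] by simp
    show ?thesis
    proof (rule winning_strategy_by_confinement[where Q = "homogeneous E (pverts G)"])
      show "finite (pverts G)" by simp
      show "homogeneous E (pverts G) (pverts G)"
        by (simp add: homogeneous_def)
      show "closed_in G (pverts G)"
        using in_arcsD2 by (auto simp: closed_in_def)
    qed (rule switching_step[OF assms(1) sym X E_def free])
  qed
  then have "flip_width r G \<le> enat 2"
    unfolding flip_width_def by (intro INF_lower) simp
  then show ?thesis
    by (simp add: numeral_eq_enat)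
qed

end
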